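(* Let $A=A_\pi=(a_{ij})$ be a real $n\times n$ matrix with $a_{i\pi(i)}>0$ for $1\le i\le n$ and all other entries zero, where the permutation $\pi$ of $\{1,\dots,n\}$ has the decomposition into disjoint cycles $$\pi=(i_{11},i_{12},\dots,i_{1k_1})(i_{21},i_{22},\dots,i_{2k_2})\cdots(i_{q1},i_{q2},\dots,i_{qk_q}),\quad 1\le q\le n,\ 1\le k_j\le n.$$ For $p=1,\dots,q$ put $Q_p=a_{i_{p1}i_{p2}}a_{i_{p2}i_{p3}}\cdots a_{i_{p(k_p-1)}i_{pk_p}}a_{i_{pk_p}i_{p1}}$. Let $x^{(0)}\in\mathcal I_n$ be an initial point and $x^{(m+1)}=A(x^{(m)})$, $m=0,1,\dots$, its trajectory. If $i\in\{i_{p1},i_{p2},\dots,i_{pk_p}\}$ for some $p=1,\dots,q$, then $$\lim_{s\to\infty}x_i^{(k_ps+r)}=\begin{cases}0, & \text{if } Q_p<1;\\[2mm] \left(\prod_{j=0}^{r-1}a_{\pi^j(i)\pi^{j+1}(i)}\right)x^{(0)}_{\pi^r(i)}, & \text{if } Q_p=1,\ 0\le r<k_p;\\[2mm] -\infty, & \text{if } Q_p>1.\end{cases}$$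
   Context: $\mathbf R_{\max}=\mathbf R\cup\{-\infty\}$ and $\mathcal I_n=\{(x_1,\dots,x_n)\in\mathbf R_{\max}^n:\max_{1\le i\le n}x_i=0\}$. The matrix acts by ordinary matrix-vector multiplication, so $(A_\pi(x))_i=a_{i\pi(i)}x_{\pi(i)}$, and it maps $\mathcal I_n$ to itself. Cycles of length $1$ are included in the decomposition (for $k_p=1$, $Q_p=a_{i_{p1}i_{p1}}$); cycle notation means $\pi(i_{js})=i_{j,s+1}$ for $s<k_j$ and $\pi(i_{jk_j})=i_{j1}$. $\pi^j$ is the $j$-th iterate of $\pi$ ($\pi^0$ is the identity), an empty product equals $1$, the time index is written as $m=k_ps+r$ with $r$ the remainder of $m$ on division by $k_p$, and limits are taken in the extended real line.
   Formalization: The printed limits fail at some initial coordinates and are corrected there: if Q_p<1 and x^{(0)}_{π^r(i)}=-∞ the limit is -∞ (not 0); if Q_p>1 and x^{(0)}_{π^r(i)}=0 the limit is 0 (not -∞), e.g. n=1, A=(2), x^{(0)}=0. *)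

theory Defs
  imports "HOL-Analysis.Analysis"
begin

text \<open>Points of \<open>R\<^sub>m\<^sub>a\<^sub>x\<^sup>n\<close> are vectors over \<^typ>\<open>ereal\<close> with no coordinate \<open>\<infinity>\<close>; the index
  set is a finite type \<open>'n\<close>, so that \<open>n = CARD('n) \<ge> 1\<close>.\<close>

definition I_max :: "(ereal ^ 'n) set" where
  "I_max = {x. (\<forall>i. x $ i \<noteq> \<infinity>) \<and> Max (range (\<lambda>i. x $ i)) = 0}"

text \<open>Ordinary matrix-vector multiplication. The operator \<open>*v\<close> is not available, since
  \<^typ>\<open>ereal\<close> is not a semiring. In \<^typ>\<open>ereal\<close> we have \<open>0 * (-\<infinity>) = 0\<close>, so zero entries
  of the matrix contribute nothing.\<close>

definition max_act :: "real ^ 'n ^ 'm \<Rightarrow> ereal ^ 'n \<Rightarrow> ereal ^ 'm" where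
  "max_act A x = (\<chi> i. \<Sum>j\<in>UNIV. ereal (A $ i $ j) * x $ j)"

text \<open>\<open>c p s\<close> is the entry \<open>i\<^sub>p\<^sub>s\<close>, for \<open>1 \<le> p \<le> q\<close> and \<open>1 \<le> s \<le> k p\<close>. The
  \<^const>\<open>bij_betw\<close> condition says that the cycles have distinct entries, are pairwise disjoint,
  and exhaust the index set (cycles of length 1 being listed).\<close>

definition cycle_decomposition ::
    "('n::finite \<Rightarrow> 'n) \<Rightarrow> nat \<Rightarrow> (nat \<Rightarrow> nat) \<Rightarrow> (nat \<Rightarrow> nat \<Rightarrow> 'n) \<Rightarrow> bool" where
  "cycle_decomposition \<pi> q k c \<longleftrightarrow>
     1 \<le> q \<and> q \<le> CARD('n) \<and>
     (\<forall>p\<in>{1..q}. 1 \<le> k p \<and> k p \<le> CARD('n)) \<and>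
     bij_betw (\<lambda>(p, s). c p s) (SIGMA p:{1..q}. {1..k p}) UNIV \<and>
     (\<forall>p\<in>{1..q}. (\<forall>s\<in>{1..<k p}. \<pi> (c p s) = c p (s + 1)) \<and> \<pi> (c p (k p)) = c p 1)"

definition cycle_weight ::
    "real ^ 'n ^ 'n \<Rightarrow> (nat \<Rightarrow> nat) \<Rightarrow> (nat \<Rightarrow> nat \<Rightarrow> 'n) \<Rightarrow> nat \<Rightarrow> real" where
  "cycle_weight A k c p =
     (\<Prod>s\<in>{1..<k p}. A $ c p s $ c p (s + 1)) * A $ c p (k p) $ c p 1"

end

theory Submission
  imports Defs
begin

text \<open>Unrolling the recursion, the coordinate \<open>i\<close> at time \<open>m\<close> is the product of the entries
  of \<open>A\<close> met along the first \<open>m\<close> steps of the \<open>\<pi>\<close>-orbit of \<open>i\<close>, times the initial coordinate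
  at \<open>\<pi>\<^sup>m i\<close>. The orbit closes up after \<open>k p\<close> steps, and one full turn contributes the factor
  \<open>Q\<^sub>p\<close> whatever its starting point, so at time \<open>k p * s + r\<close> the coordinate is a geometric
  sequence in \<open>s\<close> with ratio \<open>Q\<^sub>p\<close>, multiplied by a fixed element of \<open>[-\<infinity>, 0]\<close>.\<close>

lemma max_act_monomial:
  assumes "\<And>j. j \<noteq> l \<Longrightarrow> A $ i $ j = 0"
  shows "max_act A x $ i = ereal (A $ i $ l) * x $ l"
proof -
  have "(\<Sum>j\<in>UNIV. ereal (A $ i $ j) * x $ j) = (\<Sum>j\<in>{l}. ereal (A $ i $ j) * x $ j)"
    by (rule sum.mono_neutral_right) (auto simp: assms)
  then show ?thesis by (simp add: max_act_def)
qed

text \<open>Coordinate \<open>i\<close> at time \<open>Suc m\<close> reads coordinate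
  \<open>\<pi> i\<close> at time \<open>m\<close>, so the new factor enters at the front of the
  product and the induction must let \<open>i\<close> vary.\<close>

lemma trajectory_coordinate:
  assumes "\<And>i j. j \<noteq> \<pi> i \<Longrightarrow> A $ i $ j = 0" and "\<And>m. x (Suc m) = max_act A (x m)"
  shows "x m $ i = ereal (\<Prod>j<m. A $ (\<pi> ^^ j) i $ \<pi> ((\<pi> ^^ j) i)) * x 0 $ (\<pi> ^^ m) i"
proof (induction m arbitrary: i)
  case 0
  then show ?case by (simp flip: one_ereal_def)
next
  case (Suc m)
  have "x (Suc m) $ i = ereal (A $ i $ \<pi> i) * x m $ \<pi> i"
    unfolding assms(2) by (rule max_act_monomial) (rule assms(1))
  then show ?case
    unfolding Suc.IH prod.lessThan_Suc_shift
    by (simp add: funpow_swap1 mult.assoc flip: times_ereal.simps(1))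
qed

text \<open>Moving the start \<open>z\<close> one step along the orbit drops the factor
  \<open>g z\<close> and appends \<open>g ((f ^^ n) z)\<close>, which is the same element.\<close>

lemma funpow_cycle_start:
  assumes "n \<ge> 1" and "(f ^^ n) y = y"
  shows "(\<Prod>j<n. g ((f ^^ j) ((f ^^ t) y))) = (\<Prod>j<n. g ((f ^^ j) y) :: 'b::comm_monoid_mult)"
proof (induction t)
  case (Suc t)
  obtain l where n: "n = Suc l" using assms(1) by (cases n) auto
  define z where "z = (f ^^ t) y"
  have "(f ^^ n) z = z"
    unfolding z_def using assms(2) by (metis add.commute comp_apply funpow_add)
  then have z: "(f ^^ l) (f z) = z" by (simp add: n funpow_swap1)
  have "(\<Prod>j<n. g ((f ^^ j) (f z))) = (\<Prod>j<n. g ((f ^^ j) z))"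
    by (subst (2) n, subst prod.lessThan_Suc_shift) (simp add: n funpow_swap1 z mult.commute)
  then show ?case using Suc by (simp add: z_def)
qed simp

lemma funpow_prod_periodic:
  fixes g :: "'a \<Rightarrow> 'b::comm_monoid_mult"
  assumes "(f ^^ n) y = y"
  shows "(\<Prod>j<n * s + r. g ((f ^^ j) y)) =
    (\<Prod>j<n. g ((f ^^ j) y)) ^ s * (\<Prod>j<r. g ((f ^^ j) y))"
proof (induction s)
  case (Suc s)
  \<comment> \<open>After \<open>n\<close> steps the orbit is back at \<open>y\<close>, so the
    remaining factors restart from \<open>j = 0\<close>.\<close>
  have split: "(\<Prod>j<n + m. g ((f ^^ j) y)) = (\<Prod>j<n. g ((f ^^ j) y)) * (\<Prod>j<m. g ((f ^^ j) y))" for m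
  proof (induction m)
    case (Suc m)
    have "(f ^^ (n + m)) y = (f ^^ m) y"
      using assms by (metis add.commute comp_apply funpow_add)
    then show ?case using Suc by (simp add: mult.assoc)
  qed simp
  show ?case using Suc split[of "n * s + r"] by (simp add: add.assoc mult.assoc)
qed simp

text \<open>Links two indexings: entries of a cycle count from 1, iterates of \<open>\<pi>\<close>
  from 0.\<close>

lemma cycle_decomposition_orbit:
  assumes "cycle_decomposition \<pi> q k c" and "p \<in> {1..q}"
  shows "t < k p \<Longrightarrow> (\<pi> ^^ t) (c p 1) = c p (Suc t)"
    and "(\<pi> ^^ k p) (c p 1) = c p 1"
proof -
  have step: "\<pi> (c p s) = c p (s + 1)" if "s \<in> {1..<k p}" for s
    using assms that unfolding cycle_decomposition_def by blast
  have "k p \<ge> 1" "\<pi> (c p (k p)) = c p 1"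
    using assms unfolding cycle_decomposition_def by blast+
  show orbit: "(\<pi> ^^ t) (c p 1) = c p (Suc t)" if "t < k p" for t
    using that by (induction t) (use step in auto)
  then show "(\<pi> ^^ k p) (c p 1) = c p 1"
    using \<open>k p \<ge> 1\<close> \<open>\<pi> (c p (k p)) = c p 1\<close> by (cases "k p") auto
qed

lemma cycle_weight_eq_orbit_prod:
  assumes "cycle_decomposition \<pi> q k c" and "p \<in> {1..q}"
  shows "cycle_weight A k c p = (\<Prod>j<k p. A $ (\<pi> ^^ j) (c p 1) $ \<pi> ((\<pi> ^^ j) (c p 1)))"
proof -
  note orbit = cycle_decomposition_orbit[OF assms]
  obtain l where l: "k p = Suc l"
    using assms unfolding cycle_decomposition_def by (cases "k p") force+
  have "(\<Prod>s\<in>{1..<k p}. A $ c p s $ c p (s + 1)) = (\<Prod>j<l. A $ c p (Suc j) $ c p (Suc (Suc j)))"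
    unfolding l lessThan_atLeast0 
    by (simp only: One_nat_def prod.atLeast_Suc_lessThan_Suc_shift o_def add_Suc_right add_0_right)
  \<comment> \<open>Here \<open>j < l\<close> keeps both \<open>j\<close> and \<open>Suc j\<close>
    below \<open>k p = Suc l\<close>.\<close>
  also have "\<dots> = (\<Prod>j<l. A $ (\<pi> ^^ j) (c p 1) $ (\<pi> ^^ Suc j) (c p 1))"
    by (intro prod.cong refl, subst (1 2) orbit(1)) (auto simp: l)
  finally have "(\<Prod>s\<in>{1..<k p}. A $ c p s $ c p (s + 1)) =
      (\<Prod>j<l. A $ (\<pi> ^^ j) (c p 1) $ \<pi> ((\<pi> ^^ j) (c p 1)))" by simp
  \<comment> \<open>The closing edge of the cycle supplies the factor with
    \<open>j = l\<close>.\<close>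
  moreover have "(\<pi> ^^ l) (c p 1) = c p (k p)" "\<pi> (c p (k p)) = c p 1"
    using orbit(1)[of l] orbit(2) by (auto simp: l)
  ultimately show ?thesis by (simp add: cycle_weight_def l)
qed

text \<open>Multiplication by a positive real fixes \<open>0\<close> and
  \<open>-\<infinity>\<close>, so these two values of \<open>v\<close> give constant sequences;
  growth or decay shows only for \<open>v\<close> real and negative.\<close>

lemma tendsto_geometric_ereal:
  fixes v :: ereal
  assumes "Q > 0" "P > 0" "v \<le> 0"
  shows "(\<lambda>s. ereal (Q ^ s * P) * v) \<longlonglongrightarrow>
    (if Q < 1 then (if v = -\<infinity> then -\<infinity> else 0)
     else if Q = 1 then ereal P * v
     else (if v = 0 then 0 else -\<infinity>))"
proof (cases v)
  case (real u)
  consider "Q < 1" | "Q = 1" | "Q > 1" "u = 0" | "Q > 1" "u < 0"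
    using assms real by fastforce
  then show ?thesis
  proof cases
    case 1
    then have "(\<lambda>s. Q ^ s * P * u) \<longlonglongrightarrow> 0 * P * u"
      using assms by (intro tendsto_intros LIMSEQ_power_zero) auto
    then show ?thesis using 1 real by (simp add: zero_ereal_def)
  next
    case 4
    then have "P * u < 0" using assms by (simp add: mult_pos_neg)
    moreover have "filterlim (\<lambda>s. Q ^ s) at_top sequentially"
      using \<open>Q > 1\<close>
      by (intro filterlim_at_infinity_imp_filterlim_at_top filterlim_realpow_sequentially_gt1) auto
    ultimately have "filterlim (\<lambda>s. P * u * Q ^ s) at_bot sequentially"
      by (rule filterlim_tendsto_neg_mult_at_bot[OF tendsto_const])
    moreover have "ereal (Q ^ s * P) * v = ereal (P * u * Q ^ s)" for s
      using real by simp
    \<comment> \<open>Both notions of divergence say that the sequence is eventually below every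
      real bound.\<close>
    ultimately have "(\<lambda>s. ereal (Q ^ s * P) * v) \<longlonglongrightarrow> -\<infinity>"
      unfolding tendsto_MInfty filterlim_at_bot_dense by simp
    then show ?thesis using 4 real by (simp del: times_ereal.simps add: zero_ereal_def)
  \<comment> \<open>The two cases left, \<open>Q = 1\<close> and \<open>u = 0\<close>, are constant
    sequences.\<close>
  qed (use real in \<open>auto simp flip: zero_ereal_def\<close>)
next
  case MInf
  then show ?thesis using assms by auto
qed (use assms in auto)

text \<open>The inner conditionals are forced: an initial value \<open>-\<infinity>\<close> never
  decays to \<open>0\<close>, and an initial value \<open>0\<close> never diverges.\<close>

theorem theorem4p3:
  fixes A :: "real ^ 'n ^ 'n"
    and \<pi> :: "'n \<Rightarrow> 'n"
    and q :: nat and k :: "nat \<Rightarrow> nat" and c :: "nat \<Rightarrow> nat \<Rightarrow> 'n"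
    and x :: "nat \<Rightarrow> ereal ^ 'n"
    and p r :: nat and i :: 'n
  assumes "\<pi> permutes UNIV"
    and "\<And>i. A $ i $ \<pi> i > 0"
    and "\<And>i j. j \<noteq> \<pi> i \<Longrightarrow> A $ i $ j = 0"
    and "cycle_decomposition \<pi> q k c"
    and "x 0 \<in> I_max"
    and "\<And>m. x (Suc m) = max_act A (x m)"
    and "p \<in> {1..q}"
    and "i \<in> c p ` {1..k p}"
    and "r < k p"
  shows "(\<lambda>s. x (k p * s + r) $ i) \<longlonglongrightarrow>
    (if cycle_weight A k c p < 1 then
       (if x 0 $ (\<pi> ^^ r) i = -\<infinity> then -\<infinity> else 0)
     else if cycle_weight A k c p = 1 then
       ereal (\<Prod>j<r. A $ (\<pi> ^^ j) i $ (\<pi> ^^ (j + 1)) i) * x 0 $ (\<pi> ^^ r) i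
     else
       (if x 0 $ (\<pi> ^^ r) i = 0 then 0 else -\<infinity>))"
proof -
  define a where "a j = A $ j $ \<pi> j" for j
  define Q where "Q = cycle_weight A k c p"
  define P where "P = (\<Prod>j<r. a ((\<pi> ^^ j) i))"
  define v where "v = x 0 $ (\<pi> ^^ r) i"
  note orbit = cycle_decomposition_orbit[OF assms(4,7)]
  have "k p \<ge> 1" using \<open>r < k p\<close> by simp
  \<comment> \<open>The orbit is based at \<open>c p 1\<close>, so \<open>t\<close> is one less than
    the position of \<open>i\<close> in its cycle.\<close>
  obtain t where i: "i = (\<pi> ^^ t) (c p 1)"
  proof -
    obtain s where "s \<in> {1..k p}" "i = c p s" using assms(8) by blast
    with orbit(1)[of "s - 1"] that[of "s - 1"] show ?thesis by auto
  qed
  have period: "(\<pi> ^^ k p) i = i"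
    unfolding i using orbit(2) by (metis add.commute comp_apply funpow_add)
  have Q: "Q = (\<Prod>j<k p. a ((\<pi> ^^ j) i))"
    unfolding Q_def cycle_weight_eq_orbit_prod[OF assms(4,7)] i a_def
    using funpow_cycle_start[OF \<open>k p \<ge> 1\<close> orbit(2), of "\<lambda>j. A $ j $ \<pi> j" t] by simp
  have "(\<pi> ^^ (k p * s + r)) i = (\<pi> ^^ r) i" for s
    using funpow_mod_eq[OF period, of "k p * s + r"] \<open>r < k p\<close> by simp
  then have coord: "x (k p * s + r) $ i = ereal (Q ^ s * P) * v" for s
    using trajectory_coordinate[where \<pi> = \<pi> and x = x, OF assms(3,6), of "k p * s + r" i]
      funpow_prod_periodic[OF period, of a s r]
    by (simp add: a_def v_def Q P_def del: times_ereal.simps)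
  have "Q > 0" "P > 0"
    unfolding Q P_def a_def by (auto intro!: prod_pos assms(2))
  \<comment> \<open>Membership in \<open>I_max\<close> enters here: a maximum of \<open>0\<close>
    bounds \<open>v\<close> above and so excludes the limit \<open>\<infinity>\<close>.\<close>
  have "v \<le> Max (range (\<lambda>i. x 0 $ i))" unfolding v_def by (rule Max_ge) auto
  then have "v \<le> 0" using assms(5) by (simp add: I_max_def)
  have P: "(\<Prod>j<r. A $ (\<pi> ^^ j) i $ (\<pi> ^^ (j + 1)) i) = P"
    by (simp add: P_def a_def)
  show ?thesis
    unfolding coord P Q_def[symmetric] v_def[symmetric]
    using \<open>Q > 0\<close> \<open>P > 0\<close> \<open>v \<le> 0\<close> by (rule tendsto_geometric_ereal)
qed

end
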